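(* For any finite list $A$ of chess-piece types, the structure of chess $\mathfrak{Ch}_A$, consisting of the finite positions of infinite chess with piece specification $A$ and equipped with the relations $\mathrm{WhiteToPlay}$, $\mathrm{OneMove}$, $\mathrm{BlackInCheck}$ and $\mathrm{WhiteInCheck}$, is definable in Presburger arithmetic $\langle\mathbb{N},+\rangle$.
   Context: **Infinite chess** is chess played on the infinite edgeless board $\mathbb{Z}\times\mathbb{Z}$. **Positions.** A piece designation is a tuple $\langle i,j,x,y\rangle$ where $i\in\{K,k,Q,q,B,b,N,n,R,r,P,p\}$ is the piece type (king, queen, bishop, knight, rook, pawn; upper case white, lower case black), $j$ is a binary indicator of whether the piece is in play (live) or captured, and $(x,y)\in\mathbb{Z}\times\mathbb{Z}$ is its location (a fixed default value if captured). A finite position is a finite sequence of piece designations, with at most one king of each color and no two live pieces on the same square, together with a binary indicator of whose turn it is. A list $A$ of chess-piece types is a finite sequence of elements of $\{K,k,Q,q,B,b,N,n,R,r,P,p\}$ (with at most one $K$ and at most one $k$); a position has piece specification $A$ if the sequence of types of its piece designations, in order, is exactly $A$ (some of the pieces may be captured). **Moves.** Pieces move and capture by the usual chess rules: a king to any of the 8 adjacent squares; a knight by $(\pm1,\pm2)$ or $(\pm2,\pm1)$, with no obstruction possible; rooks along ranks and files, bishops along diagonals, queens along either, any positive distance, with no live piece strictly between; a white pawn advances by $(0,+1)$ to an empty square or captures an opposing piece by $(\pm1,+1)$; a black pawn advances by $(0,-1)$ to an empty square or captures by $(\pm1,-1)$. There is no pawn promotion, no initial two-step pawn move, no en passant and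 no castling. A piece attacks a square if it is live and could move so as to capture an opposing piece on that square, irrespective of whether a friendly piece is there and irrespective of pins. A player is in check if that player's king is live and attacked by a live opposing piece. A legal move is a move by the player whose turn it is, to a square not occupied by a friendly piece (any opposing piece there being captured), after which the moving player is not in check; the turn then passes to the opponent. **The structure $\mathfrak{Ch}_A$.** Its domain is the set of all finite positions with piece specification $A$. Its relations are: $\mathrm{WhiteToPlay}(p)$, it is white's turn in $p$; $\mathrm{OneMove}(p,q)$, some legal move transforms $p$ into $q$, where the order of listing of the pieces is preserved and captured pieces remain listed but are marked captured (with the default location); $\mathrm{BlackInCheck}(p)$ and $\mathrm{WhiteInCheck}(p)$, black (respectively white) is in check in $p$. **Definable in Presburger arithmetic** means: positions with piece specification $A$ can be coded injectively by tuples of natural numbers of a fixed length $m$ (depending on $A$; each piece being coded by numbers indicating its type, whether it is in play, and its location, with extra numbers for sign bits) so that the set of codes is a subset of $\mathbb{N}^m$ first-order definable in $\langle\mathbb{N},+\rangle$, and each of the relations of $\mathfrak{Ch}_A$ corresponds under the coding to a relation first-order definable in $\langle\mathbb{N},+\rangle$. *)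

theory Defs
  imports Main
begin

section \<open>Definability in Presburger arithmetic\<close>

text \<open>First-order formulas with equality over the language whose only symbol is the binary
  function symbol of addition, interpreted in the natural numbers.\<close>

datatype tm = Var nat | Plus tm tm

datatype fm = Equal tm tm | Neg fm | Conj fm fm | Exists nat fm

primrec val :: "(nat \<Rightarrow> nat) \<Rightarrow> tm \<Rightarrow> nat" where
  "val e (Var i) = e i"
| "val e (Plus s t) = val e s + val e t"

primrec sat :: "(nat \<Rightarrow> nat) \<Rightarrow> fm \<Rightarrow> bool" where
  "sat e (Equal s t) \<longleftrightarrow> val e s = val e t"
| "sat e (Neg \<phi>) \<longleftrightarrow> \<not> sat e \<phi>"
| "sat e (Conj \<phi> \<psi>) \<longleftrightarrow> sat e \<phi> \<and> sat e \<psi>"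
| "sat e (Exists i \<phi>) \<longleftrightarrow> (\<exists>n. sat (e(i := n)) \<phi>)"

primrec tvars :: "tm \<Rightarrow> nat set" where
  "tvars (Var i) = {i}"
| "tvars (Plus s t) = tvars s \<union> tvars t"

primrec fvars :: "fm \<Rightarrow> nat set" where
  "fvars (Equal s t) = tvars s \<union> tvars t"
| "fvars (Neg \<phi>) = fvars \<phi>"
| "fvars (Conj \<phi> \<psi>) = fvars \<phi> \<union> fvars \<psi>"
| "fvars (Exists i \<phi>) = fvars \<phi> - {i}"

text \<open>Elements of \<open>\<nat>\<^sup>m\<close> are lists of length \<open>m\<close>. The free variables are restricted to those
  naming coordinates, so the values of \<open>(!) v\<close> beyond the length of \<open>v\<close> are irrelevant.\<close>

definition presburger_definable :: "nat \<Rightarrow> nat list set \<Rightarrow> bool" where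
  "presburger_definable m S \<longleftrightarrow>
     (\<exists>\<phi>. fvars \<phi> \<subseteq> {..<m} \<and> S = {v. length v = m \<and> sat ((!) v) \<phi>})"

record ('r, 'a) relational_structure =
  domain :: "'a set"
  arity :: "'r \<Rightarrow> nat"
  interp :: "'r \<Rightarrow> 'a list set"

text \<open>Tuples of elements are coded by concatenating the codes, so a \<open>k\<close>-ary relation becomes
  a subset of \<open>\<nat>\<^sup>k\<^sup>m\<close>.\<close>

definition presburger_definable_via ::
  "nat \<Rightarrow> ('a \<Rightarrow> nat list) \<Rightarrow> ('r, 'a) relational_structure \<Rightarrow> bool" where
  "presburger_definable_via m code M \<longleftrightarrow>
     inj_on code (domain M) \<and>
     (\<forall>p \<in> domain M. length (code p) = m) \<and>
     presburger_definable m (code ` domain M) \<and>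
     (\<forall>r. presburger_definable (arity M r * m) ((\<lambda>ps. concat (map code ps)) ` interp M r))"


section \<open>Infinite chess\<close>

datatype color = White | Black

datatype kind = King | Queen | Bishop | Knight | Rook | Pawn

type_synonym piece_type = "color \<times> kind"

type_synonym square = "int \<times> int"

record piece =
  ptype :: piece_type
  live :: bool
  loc :: square

abbreviation pcolor :: "piece \<Rightarrow> color" where
  "pcolor d \<equiv> fst (ptype d)"

abbreviation pkind :: "piece \<Rightarrow> kind" where
  "pkind d \<equiv> snd (ptype d)"

record position =
  pieces :: "piece list"
  turn :: color

primrec opponent :: "color \<Rightarrow> color" where
  "opponent White = Black"
| "opponent Black = White"

definition at_most_one_king_each :: "piece_type list \<Rightarrow> bool" where
  "at_most_one_king_each A \<longleftrightarrow> (\<forall>c. count_list A (c, King) \<le> 1)"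

definition default_loc :: square where
  "default_loc = (0, 0)"

definition valid_position :: "position \<Rightarrow> bool" where
  "valid_position p \<longleftrightarrow>
     at_most_one_king_each (map ptype (pieces p)) \<and>
     (\<forall>d \<in> set (pieces p). \<not> live d \<longrightarrow> loc d = default_loc) \<and>
     (\<forall>i < length (pieces p). \<forall>j < length (pieces p).
        i \<noteq> j \<and> live (pieces p ! i) \<and> live (pieces p ! j) \<longrightarrow>
        loc (pieces p ! i) \<noteq> loc (pieces p ! j))"

definition positions :: "piece_type list \<Rightarrow> position set" where
  "positions A = {p. valid_position p \<and> map ptype (pieces p) = A}"


subsection \<open>Moves\<close>

definition occupied :: "piece list \<Rightarrow> square \<Rightarrow> bool" where
  "occupied ps s \<longleftrightarrow> (\<exists>d \<in> set ps. live d \<and> loc d = s)"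

definition occupied_by :: "color \<Rightarrow> piece list \<Rightarrow> square \<Rightarrow> bool" where
  "occupied_by c ps s \<longleftrightarrow> (\<exists>d \<in> set ps. live d \<and> pcolor d = c \<and> loc d = s)"

definition offset :: "square \<Rightarrow> int \<Rightarrow> int \<times> int \<Rightarrow> square" where
  "offset s n u = (fst s + n * fst u, snd s + n * snd u)"

definition rook_dirs :: "(int \<times> int) set" where
  "rook_dirs = {(1, 0), (-1, 0), (0, 1), (0, -1)}"

definition bishop_dirs :: "(int \<times> int) set" where
  "bishop_dirs = {(1, 1), (1, -1), (-1, 1), (-1, -1)}"

definition knight_jumps :: "(int \<times> int) set" where
  "knight_jumps = {(1, 2), (1, -2), (-1, 2), (-1, -2), (2, 1), (2, -1), (-2, 1), (-2, -1)}"

definition steps :: "(int \<times> int) set \<Rightarrow> square \<Rightarrow> square \<Rightarrow> bool" where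
  "steps U s t \<longleftrightarrow> (\<exists>u \<in> U. t = offset s 1 u)"

definition slides :: "(int \<times> int) set \<Rightarrow> piece list \<Rightarrow> square \<Rightarrow> square \<Rightarrow> bool" where
  "slides U ps s t \<longleftrightarrow>
     (\<exists>u \<in> U. \<exists>n > 0. t = offset s n u \<and>
        (\<forall>k. 0 < k \<and> k < n \<longrightarrow> \<not> occupied ps (offset s k u)))"

primrec forward :: "color \<Rightarrow> int" where
  "forward White = 1"
| "forward Black = -1"

definition attacks :: "piece list \<Rightarrow> piece \<Rightarrow> square \<Rightarrow> bool" where
  "attacks ps d t \<longleftrightarrow> live d \<and>
     (case pkind d of
        King \<Rightarrow> steps (rook_dirs \<union> bishop_dirs) (loc d) t
      | Queen \<Rightarrow> slides (rook_dirs \<union> bishop_dirs) ps (loc d) t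
      | Bishop \<Rightarrow> slides bishop_dirs ps (loc d) t
      | Knight \<Rightarrow> steps knight_jumps (loc d) t
      | Rook \<Rightarrow> slides rook_dirs ps (loc d) t
      | Pawn \<Rightarrow> steps {(1, forward (pcolor d)), (-1, forward (pcolor d))} (loc d) t)"

definition in_check :: "color \<Rightarrow> piece list \<Rightarrow> bool" where
  "in_check c ps \<longleftrightarrow>
     (\<exists>d \<in> set ps. \<exists>e \<in> set ps.
        ptype d = (c, King) \<and> live d \<and> pcolor e = opponent c \<and> attacks ps e (loc d))"

definition can_move :: "piece list \<Rightarrow> piece \<Rightarrow> square \<Rightarrow> bool" where
  "can_move ps d t \<longleftrightarrow> live d \<and> \<not> occupied_by (pcolor d) ps t \<and>
     (if pkind d = Pawn
      then steps {(0, forward (pcolor d))} (loc d) t \<and> \<not> occupied ps t \<or>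
           attacks ps d t \<and> occupied_by (opponent (pcolor d)) ps t
      else attacks ps d t)"

definition capture_at :: "square \<Rightarrow> piece list \<Rightarrow> piece list" where
  "capture_at t ps =
     map (\<lambda>d. if live d \<and> loc d = t then d\<lparr>live := False, loc := default_loc\<rparr> else d) ps"

definition legal_move :: "position \<Rightarrow> position \<Rightarrow> bool" where
  "legal_move p q \<longleftrightarrow>
     (\<exists>i < length (pieces p). \<exists>t.
        pcolor (pieces p ! i) = turn p \<and>
        can_move (pieces p) (pieces p ! i) t \<and>
        pieces q = (capture_at t (pieces p))[i := (pieces p ! i)\<lparr>loc := t\<rparr>] \<and>
        turn q = opponent (turn p) \<and>
        \<not> in_check (turn p) (pieces q))"


subsection \<open>The structure of chess\<close>

datatype chess_rel = WhiteToPlay | OneMove | BlackInCheck | WhiteInCheck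

primrec chess_arity :: "chess_rel \<Rightarrow> nat" where
  "chess_arity WhiteToPlay = 1"
| "chess_arity OneMove = 2"
| "chess_arity BlackInCheck = 1"
| "chess_arity WhiteInCheck = 1"

primrec chess_interp :: "piece_type list \<Rightarrow> chess_rel \<Rightarrow> position list set" where
  "chess_interp A WhiteToPlay = {[p] | p. p \<in> positions A \<and> turn p = White}"
| "chess_interp A OneMove =
     {[p, q] | p q. p \<in> positions A \<and> q \<in> positions A \<and> legal_move p q}"
| "chess_interp A BlackInCheck = {[p] | p. p \<in> positions A \<and> in_check Black (pieces p)}"
| "chess_interp A WhiteInCheck = {[p] | p. p \<in> positions A \<and> in_check White (pieces p)}"

definition chess :: "piece_type list \<Rightarrow> (chess_rel, position) relational_structure" where
  "chess A = \<lparr>domain = positions A, arity = chess_arity, interp = chess_interp A\<rparr>"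


subsection \<open>Coding positions by tuples of natural numbers\<close>

text \<open>An integer is coded by a sign bit followed by its absolute value. The sign bit of \<open>0\<close> is
  \<open>0\<close>, which makes the code unique. The numbering \<open>\<nu>\<close> of the piece types is a parameter.\<close>

definition int_code :: "int \<Rightarrow> nat list" where
  "int_code x = [if x < 0 then 1 else 0, nat \<bar>x\<bar>]"

definition piece_code :: "(piece_type \<Rightarrow> nat) \<Rightarrow> piece \<Rightarrow> nat list" where
  "piece_code \<nu> d =
     [\<nu> (ptype d), if live d then 1 else 0] @ int_code (fst (loc d)) @ int_code (snd (loc d))"

definition position_code :: "(piece_type \<Rightarrow> nat) \<Rightarrow> position \<Rightarrow> nat list" where
  "position_code \<nu> p =
     (if turn p = White then 1 else 0) # concat (map (piece_code \<nu>) (pieces p))"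

end

theory Submission
  imports Defs
begin

text \<open>The piece types in \<open>A\<close> are fixed in advance, so a position is a fixed number of integers
  and every quantifier over pieces in the rules of chess is a finite conjunction or disjunction.
  Every quantifier over directions is finite as well. The remaining ones, over squares and numbers
  of steps, can be removed.

  \<^item> A sliding piece needs every square between its start and its target to be empty. Instead of
    the unboundedly many squares, one inspects the finitely many pieces: none of them may lie
    between the two squares (\<open>slides_iff_on_ray\<close>). Lying on a common ray is a linear condition,
    because all coordinates of the directions are \<open>0\<close>, \<open>1\<close> or \<open>-1\<close> (\<open>definable_on_ray\<close>).
  \<^item> The target of a move need not be guessed, since it is the location of the moved piece in the
    resulting position (\<open>legal_move_iff_target\<close>).

  Hence every relation of the structure is a Boolean combination of linear inequalities
  between coordinates. A coordinate is not itself a variable, but a case distinction on a sign bit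
  applied to one; this is why the inequalities are treated for piecewise affine functions
  (\<open>definable_nonneg\<close>). In the formulas, quantifiers serve only to express the order and the
  constants, and to discard surplus variables.

  To pass between tuples of numbers and positions, the code is inverted: \<open>position_at\<close> reads a
  position off an environment, and \<open>position_code_iff\<close> describes which environments carry the
  code of a position. Injectivity of the code follows from the same equivalence.\<close>


section \<open>Presburger-definable conditions on environments\<close>

type_synonym env = "nat \<Rightarrow> nat"

text \<open>The formula may mention any variables and must agree with \<open>P\<close> on all environments. This makes
  the closure properties free of side conditions; the restriction to the coordinates of a tuple is
  restored once, in \<open>presburger_definableI\<close>.\<close>
definition definable :: "(env \<Rightarrow> bool) \<Rightarrow> bool" where
  "definable P \<longleftrightarrow> (\<exists>\<phi>. \<forall>e. sat e \<phi> \<longleftrightarrow> P e)"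

lemma definable_not: "definable P \<Longrightarrow> definable (\<lambda>e. \<not> P e)"
proof -
  assume "definable P"
  then obtain \<phi> where "\<And>e. sat e \<phi> \<longleftrightarrow> P e"
    unfolding definable_def by blast
  then have "\<forall>e. sat e (Neg \<phi>) \<longleftrightarrow> \<not> P e" by simp
  then show ?thesis unfolding definable_def by (rule exI)
qed

lemma definable_conj: "definable P \<Longrightarrow> definable Q \<Longrightarrow> definable (\<lambda>e. P e \<and> Q e)"
proof -
  assume "definable P" "definable Q"
  then obtain \<phi> \<psi> where "\<And>e. sat e \<phi> \<longleftrightarrow> P e" "\<And>e. sat e \<psi> \<longleftrightarrow> Q e"
    unfolding definable_def by blast
  then have "\<forall>e. sat e (Conj \<phi> \<psi>) \<longleftrightarrow> P e \<and> Q e" by simp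
  then show ?thesis unfolding definable_def by (rule exI)
qed

lemma definable_disj: "definable P \<Longrightarrow> definable Q \<Longrightarrow> definable (\<lambda>e. P e \<or> Q e)"
  using definable_not[OF definable_conj[OF definable_not definable_not], of P Q] by simp

lemma definable_imp: "definable P \<Longrightarrow> definable Q \<Longrightarrow> definable (\<lambda>e. P e \<longrightarrow> Q e)"
  unfolding imp_conv_disj by (intro definable_disj definable_not)

lemma definable_iff: "definable P \<Longrightarrow> definable Q \<Longrightarrow> definable (\<lambda>e. P e \<longleftrightarrow> Q e)"
  unfolding iff_conv_conj_imp by (intro definable_conj definable_imp)

lemma definable_if:
  "definable C \<Longrightarrow> definable P \<Longrightarrow> definable Q \<Longrightarrow> definable (\<lambda>e. if C e then P e else Q e)"
  unfolding if_bool_eq_conj by (intro definable_conj definable_imp definable_not)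

lemma definable_True: "definable (\<lambda>e. True)"
  unfolding definable_def by (rule exI[of _ "Equal (Var 0) (Var 0)"]) simp

lemma definable_const: "definable (\<lambda>e. b)"
  using definable_True definable_not[OF definable_True] by (cases b) auto

lemma definable_bex:
  assumes "finite U" "\<And>u. u \<in> U \<Longrightarrow> definable (P u)"
  shows "definable (\<lambda>e. \<exists>u\<in>U. P u e)"
  using assms by (induction U) (simp_all add: definable_const definable_disj)

lemma definable_ball:
  assumes "finite U" "\<And>u. u \<in> U \<Longrightarrow> definable (P u)"
  shows "definable (\<lambda>e. \<forall>u\<in>U. P u e)"
  using assms by (induction U) (simp_all add: definable_const definable_conj)

lemma definable_ex_less:
  "(\<And>i. i < n \<Longrightarrow> definable (P i)) \<Longrightarrow> definable (\<lambda>e. \<exists>i<n. P i e)" for n :: nat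
  using definable_bex[of "{..<n}" P] by (simp add: Bex_def)

lemma definable_all_less:
  "(\<And>i. i < n \<Longrightarrow> definable (P i)) \<Longrightarrow> definable (\<lambda>e. \<forall>i<n. P i e)" for n :: nat
  using definable_ball[of "{..<n}" P] by (simp add: Ball_def)


subsection \<open>Dependence on the variables\<close>

lemma val_cong: "(\<And>i. i \<in> tvars t \<Longrightarrow> e i = e' i) \<Longrightarrow> val e t = val e' t"
  by (induction t) auto

lemma sat_cong: "(\<And>i. i \<in> fvars \<phi> \<Longrightarrow> e i = e' i) \<Longrightarrow> sat e \<phi> \<longleftrightarrow> sat e' \<phi>"
proof (induction \<phi> arbitrary: e e')
  case (Equal s t)
  then have "val e s = val e' s" "val e t = val e' t"
    by (auto intro!: val_cong)
  then show ?case by simp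
next
  case (Exists i \<phi>)
  have "sat (e(i := n)) \<phi> \<longleftrightarrow> sat (e'(i := n)) \<phi>" for n
    by (rule Exists.IH) (use Exists.prems in auto)
  then show ?case by simp
next
  case (Neg \<phi>)
  then show ?case by (metis fvars.simps(2) sat.simps(2))
next
  case (Conj \<phi> \<psi>)
  have "sat e \<phi> \<longleftrightarrow> sat e' \<phi>" "sat e \<psi> \<longleftrightarrow> sat e' \<psi>"
    by (rule Conj.IH, use Conj.prems in simp)+
  then show ?case by simp
qed

lemma finite_tvars: "finite (tvars t)"
  by (induction t) auto

lemma finite_fvars: "finite (fvars \<phi>)"
  by (induction \<phi>) (auto simp: finite_tvars)

definition zero_extend :: "nat list \<Rightarrow> env" where
  "zero_extend v i = (if i < length v then v ! i else 0)"

text \<open>The language has no constant for zero, so a surplus variable cannot be substituted away.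
  Instead it is bound by a quantifier that forces \<open>x + x = x\<close>.\<close>
lemma eliminate_variables:
  assumes "finite W"
  shows "\<exists>\<psi>. fvars \<psi> = fvars \<phi> - W \<and>
           (\<forall>e. sat e \<psi> \<longleftrightarrow> sat (\<lambda>i. if i \<in> W then 0 else e i) \<phi>)"
  using assms
proof (induction W)
  case empty
  show ?case by (rule exI[of _ \<phi>]) simp
next
  case (insert j W)
  then obtain \<psi> where \<psi>: "fvars \<psi> = fvars \<phi> - W"
    "\<And>e. sat e \<psi> \<longleftrightarrow> sat (\<lambda>i. if i \<in> W then 0 else e i) \<phi>"
    by (elim exE conjE) (rule that, auto)
  let ?\<chi> = "Exists j (Conj (Equal (Plus (Var j) (Var j)) (Var j)) \<psi>)"
  have "sat e ?\<chi> \<longleftrightarrow> sat (\<lambda>i. if i \<in> insert j W then 0 else e i) \<phi>" for e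
  proof -
    have "(\<lambda>i. if i \<in> W then 0 else (e(j := 0)) i) = (\<lambda>i. if i \<in> insert j W then 0 else e i)"
      by auto
    moreover have "sat e ?\<chi> \<longleftrightarrow> sat (e(j := 0)) \<psi>" by simp
    ultimately show ?thesis using \<psi>(2)[of "e(j := 0)"] by metis
  qed
  moreover have "fvars ?\<chi> = fvars \<phi> - insert j W"
    using \<psi>(1) by auto
  ultimately show ?case by (intro exI[of _ ?\<chi>] conjI allI)
qed

text \<open>Evaluation is at \<open>zero_extend v\<close>, not at \<open>(!) v\<close>, since the latter is unspecified beyond the
  length of \<open>v\<close>. Thus \<open>P\<close> may read arbitrary positions of its environment.\<close>
lemma presburger_definableI:
  assumes "definable P"
  shows "presburger_definable m {v. length v = m \<and> P (zero_extend v)}"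
proof -
  obtain \<phi> where \<phi>: "\<And>e. sat e \<phi> \<longleftrightarrow> P e"
    using assms unfolding definable_def by blast
  obtain \<psi> where \<psi>: "fvars \<psi> = fvars \<phi> - (fvars \<phi> - {..<m})"
    "\<And>e. sat e \<psi> \<longleftrightarrow> sat (\<lambda>i. if i \<in> fvars \<phi> - {..<m} then 0 else e i) \<phi>"
    using eliminate_variables[of "fvars \<phi> - {..<m}" \<phi>] finite_fvars by blast
  have "sat ((!) v) \<psi> \<longleftrightarrow> P (zero_extend v)" if "length v = m" for v
    unfolding \<psi>(2) \<phi>[symmetric]
    by (rule sat_cong) (use that in \<open>auto simp: zero_extend_def\<close>)
  then show ?thesis
    unfolding presburger_definable_def using \<psi>(1)
    by (intro exI[of _ \<psi>] conjI Collect_cong) auto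
qed


section \<open>Affine integer conditions\<close>

text \<open>The integer constant has to be kept apart from the two terms, because no term denotes a
  nonzero constant.\<close>
definition affine :: "(env \<Rightarrow> int) \<Rightarrow> bool" where
  "affine f \<longleftrightarrow> (\<exists>s t c. \<forall>e. f e = int (val e s) - int (val e t) + c)"

lemma affine_const: "affine (\<lambda>e. c)"
  unfolding affine_def by (rule exI[of _ "Var 0"], rule exI[of _ "Var 0"]) auto

lemma affine_var: "affine (\<lambda>e. int (e i))"
  unfolding affine_def
  by (rule exI[of _ "Plus (Var i) (Var i)"], rule exI[of _ "Var i"]) auto

lemma affine_add:
  assumes "affine f" "affine g"
  shows "affine (\<lambda>e. f e + g e)"
proof -
  obtain s t c s' t' c' where
    "\<And>e. f e = int (val e s) - int (val e t) + c"
    "\<And>e. g e = int (val e s') - int (val e t') + c'"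
    using assms unfolding affine_def by blast
  then have "f e + g e = int (val e (Plus s s')) - int (val e (Plus t t')) + (c + c')" for e
    by simp
  then show ?thesis unfolding affine_def by blast
qed

lemma affine_uminus:
  assumes "affine f"
  shows "affine (\<lambda>e. - f e)"
proof -
  obtain s t c where "\<And>e. f e = int (val e s) - int (val e t) + c"
    using assms unfolding affine_def by blast
  then have "- f e = int (val e t) - int (val e s) + (- c)" for e
    by simp
  then show ?thesis unfolding affine_def by blast
qed

text \<open>The number one is the only nonzero number that is not a sum of two nonzero numbers. Being
  zero is again expressed by \<open>x + x = x\<close>.\<close>
definition is_one :: "nat \<Rightarrow> fm" where
  "is_one i =
     Conj (Neg (Equal (Plus (Var i) (Var i)) (Var i)))
       (Neg (Exists (i + 1) (Exists (i + 2)
         (Conj (Equal (Plus (Var (i + 1)) (Var (i + 2))) (Var i))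
           (Conj (Neg (Equal (Plus (Var (i + 1)) (Var (i + 1))) (Var (i + 1))))
                 (Neg (Equal (Plus (Var (i + 2)) (Var (i + 2))) (Var (i + 2)))))))))"

lemma sat_is_one: "sat e (is_one i) \<longleftrightarrow> e i = 1"
proof -
  have "(\<forall>a b. a + b = n \<longrightarrow> a = 0 \<or> b = 0) \<longleftrightarrow> n \<le> 1" for n :: nat
  proof
    assume *: "\<forall>a b. a + b = n \<longrightarrow> a = 0 \<or> b = 0"
    show "n \<le> 1"
      using *[rule_format, of 1 "n - 1"] by linarith
  qed auto
  note this[of "e i"]
  then show ?thesis
    unfolding is_one_def by auto
qed

definition plus_times :: "tm \<Rightarrow> nat \<Rightarrow> nat \<Rightarrow> tm" where
  "plus_times s k i = ((\<lambda>u. Plus u (Var i)) ^^ k) s"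

lemma val_plus_times: "val e (plus_times s k i) = val e s + k * e i"
  unfolding plus_times_def by (induction k) auto

text \<open>Moving all negative parts to the other side turns \<open>0 \<le> s - t + c\<close> into an inequality between
  sums of natural numbers, which holds if and only if some number \<open>z\<close> makes up the difference. The
  constant \<open>c\<close> is written as a multiple of a variable that is forced to be one.\<close>
lemma definable_affine_nonneg:
  assumes "affine f"
  shows "definable (\<lambda>e. 0 \<le> f e)"
proof -
  obtain s t c where f: "\<And>e. f e = int (val e s) - int (val e t) + c"
    using assms unfolding affine_def by blast
  obtain n where n: "\<And>i. i \<in> tvars s \<union> tvars t \<Longrightarrow> i < n"
    using finite_tvars[of s] finite_tvars[of t] by (metis finite_Un finite_nat_set_iff_bounded)
  have val: "val (e(n := a, Suc n := b)) s = val e s" "val (e(n := a, Suc n := b)) t = val e t"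
    for e a b
    using n by (fastforce intro!: val_cong)+
  \<comment> \<open>At most one of \<open>nat c\<close> and \<open>nat (- c)\<close> is nonzero, so \<open>c\<close> is added on the correct side.\<close>
  let ?\<phi> = "Exists n (Conj (is_one n)
    (Exists (Suc n) (Equal (Plus (plus_times t (nat (- c)) n) (Var (Suc n))) (plus_times s (nat c) n))))"
  have "sat e ?\<phi> \<longleftrightarrow> (\<exists>z. val e t + nat (- c) + z = val e s + nat c)" for e
    by (simp add: sat_is_one val_plus_times val)
  also have "\<dots> e \<longleftrightarrow> val e t + nat (- c) \<le> val e s + nat c" for e
    by (metis le_iff_add)
  also have "\<dots> e \<longleftrightarrow> 0 \<le> f e" for e
    unfolding f by linarith
  finally show ?thesis
    unfolding definable_def by blast
qed

text \<open>The induction rule of this predicate pulls case distinctions out of sums and inequalities, so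
  that atomic conditions on functions such as \<open>int_at\<close> below reduce to affine ones.\<close>
inductive piecewise_affine :: "(env \<Rightarrow> int) \<Rightarrow> bool" where
  affine: "affine f \<Longrightarrow> piecewise_affine f"
| branch: "definable C \<Longrightarrow> piecewise_affine f \<Longrightarrow> piecewise_affine g \<Longrightarrow>
    piecewise_affine (\<lambda>e. if C e then f e else g e)"

lemma piecewise_affine_const: "piecewise_affine (\<lambda>e. c)"
  by (intro piecewise_affine.affine affine_const)

lemma piecewise_affine_var: "piecewise_affine (\<lambda>e. int (e i))"
  by (intro piecewise_affine.affine affine_var)

lemma piecewise_affine_uminus: "piecewise_affine f \<Longrightarrow> piecewise_affine (\<lambda>e. - f e)"
  by (induction rule: piecewise_affine.induct)
    (simp_all add: piecewise_affine.intros affine_uminus if_distrib[of uminus])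

lemma piecewise_affine_add:
  assumes "piecewise_affine f" "piecewise_affine g"
  shows "piecewise_affine (\<lambda>e. f e + g e)"
  using assms(1)
proof (induction rule: piecewise_affine.induct)
  case (affine f)
  from assms(2) show ?case
  proof (induction rule: piecewise_affine.induct)
    case (affine g)
    then show ?case by (intro piecewise_affine.affine affine_add \<open>affine f\<close>)
  next
    case (branch C g g')
    then show ?case by (simp add: if_distrib[of "(+) _"] piecewise_affine.branch)
  qed
next
  case (branch C f f')
  then show ?case by (simp add: if_distrib[of "\<lambda>x. x + _"] piecewise_affine.branch)
qed

lemma piecewise_affine_diff:
  "piecewise_affine f \<Longrightarrow> piecewise_affine g \<Longrightarrow> piecewise_affine (\<lambda>e. f e - g e)"
  using piecewise_affine_add[of f "\<lambda>e. - g e"] piecewise_affine_uminus[of g] by simp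

lemma piecewise_affine_mult:
  assumes "piecewise_affine f"
  shows "piecewise_affine (\<lambda>e. c * f e)"
proof -
  have nat: "piecewise_affine (\<lambda>e. int k * f e)" for k
    by (induction k)
      (simp_all add: piecewise_affine_const distrib_right piecewise_affine_add assms)
  show ?thesis
    using nat[of "nat c"] piecewise_affine_uminus[OF nat[of "nat (- c)"]]
    by (cases "0 \<le> c") simp_all
qed

lemma definable_nonneg: "piecewise_affine f \<Longrightarrow> definable (\<lambda>e. 0 \<le> f e)"
proof (induction rule: piecewise_affine.induct)
  case (affine f)
  then show ?case by (rule definable_affine_nonneg)
next
  case (branch C f g)
  then show ?case by (simp add: if_distrib[of "(\<le>) 0"] definable_if)
qed

lemma definable_le:
  "piecewise_affine f \<Longrightarrow> piecewise_affine g \<Longrightarrow> definable (\<lambda>e. f e \<le> g e)"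
  using definable_nonneg[OF piecewise_affine_diff[of g f]] by simp

lemma definable_less:
  "piecewise_affine f \<Longrightarrow> piecewise_affine g \<Longrightarrow> definable (\<lambda>e. f e < g e)"
  using definable_not[OF definable_le[of g f]] by (simp add: not_le)

lemma definable_eq:
  "piecewise_affine f \<Longrightarrow> piecewise_affine g \<Longrightarrow> definable (\<lambda>e. f e = g e)"
  unfolding order_eq_iff by (intro definable_conj definable_le)

lemma definable_var_eq: "definable (\<lambda>e. e i = k)"
  using definable_eq[OF piecewise_affine_var[of i] piecewise_affine_const[of "int k"]] by simp

lemmas definable_intros =
  definable_const definable_not definable_conj definable_disj definable_imp definable_iff
  definable_if definable_le definable_less definable_eq definable_var_eq

lemmas piecewise_affine_intros =
  piecewise_affine_const piecewise_affine_var piecewise_affine_uminus piecewise_affine_add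
  piecewise_affine_diff piecewise_affine_mult piecewise_affine.branch


section \<open>Geometry of the board\<close>

definition definable_square :: "(env \<Rightarrow> square) \<Rightarrow> bool" where
  "definable_square s \<longleftrightarrow>
     piecewise_affine (\<lambda>e. fst (s e)) \<and> piecewise_affine (\<lambda>e. snd (s e))"

lemma definable_square_eq:
  assumes "definable_square s" "definable_square t"
  shows "definable (\<lambda>e. s e = t e)"
  using assms unfolding definable_square_def prod_eq_iff
  by (intro definable_intros) auto

lemma definable_square_if:
  assumes "definable C" "definable_square s" "definable_square t"
  shows "definable_square (\<lambda>e. if C e then s e else t e)"
  using assms unfolding definable_square_def if_distrib[of fst] if_distrib[of snd]
  by (intro conjI piecewise_affine.branch) auto

lemma definable_steps:
  assumes "finite U" "definable_square s" "definable_square t"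
  shows "definable (\<lambda>e. steps U (s e) (t e))"
  unfolding steps_def
  by (intro definable_bex definable_square_eq assms)
    (use assms in \<open>auto simp: definable_square_def offset_def intro!: piecewise_affine_intros\<close>)

definition on_ray :: "int \<times> int \<Rightarrow> square \<Rightarrow> square \<Rightarrow> bool" where
  "on_ray u s t \<longleftrightarrow> (\<exists>n>0. t = offset s n u)"

text \<open>A piece obstructs the way from \<open>s\<close> to \<open>t\<close> exactly if it is reached from \<open>s\<close> and reaches \<open>t\<close> in
  the same direction. For the direction \<open>(0, 0)\<close> the step counts would not be determined by the
  squares.\<close>
lemma slides_iff_on_ray:
  assumes "(0, 0) \<notin> U"
  shows "slides U ps s t \<longleftrightarrow>
    (\<exists>u\<in>U. on_ray u s t \<and> \<not> (\<exists>d\<in>set ps. live d \<and> on_ray u s (loc d) \<and> on_ray u (loc d) t))"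
proof -
  have between: "(\<exists>k. 0 < k \<and> k < n \<and> r = offset s k u) \<longleftrightarrow>
      on_ray u s r \<and> on_ray u r (offset s n u)" if "u \<noteq> (0, 0)" for u n r
  proof
    assume "\<exists>k. 0 < k \<and> k < n \<and> r = offset s k u"
    then obtain k where "0 < k" "k < n" "r = offset s k u" by blast
    moreover from this have "offset s n u = offset r (n - k) u"
      by (simp add: offset_def algebra_simps)
    ultimately show "on_ray u s r \<and> on_ray u r (offset s n u)"
      unfolding on_ray_def by (metis diff_gt_0_iff_gt)
  next
    assume "on_ray u s r \<and> on_ray u r (offset s n u)"
    then obtain k l where kl: "0 < k" "r = offset s k u" "0 < l" "offset s n u = offset r l u"
      unfolding on_ray_def by blast
    then have "n * fst u = (k + l) * fst u" "n * snd u = (k + l) * snd u"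
      by (auto simp: offset_def algebra_simps)
    then have "n = k + l"
      using that by (cases u) auto
    then show "\<exists>k. 0 < k \<and> k < n \<and> r = offset s k u"
      using kl by auto
  qed
  have clear: "(\<forall>k. 0 < k \<and> k < n \<longrightarrow> \<not> occupied ps (offset s k u)) \<longleftrightarrow>
      \<not> (\<exists>d\<in>set ps. live d \<and> on_ray u s (loc d) \<and> on_ray u (loc d) (offset s n u))"
    if "u \<in> U" for u n
  proof -
    have "u \<noteq> (0, 0)" using that assms by blast
    then show ?thesis
      unfolding between[OF \<open>u \<noteq> (0, 0)\<close>, symmetric] occupied_def by metis
  qed
  have "(\<exists>n>0. t = offset s n u \<and>
        (\<forall>k. 0 < k \<and> k < n \<longrightarrow> \<not> occupied ps (offset s k u))) \<longleftrightarrow>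
      on_ray u s t \<and> \<not> (\<exists>d\<in>set ps. live d \<and> on_ray u s (loc d) \<and> on_ray u (loc d) t)"
    if "u \<in> U" for u
    unfolding clear[OF that] on_ray_def[of u s t] by blast
  then show ?thesis
    unfolding slides_def by (simp cong: bex_cong)
qed

text \<open>The number of steps is plus or minus a difference of coordinates, for the directions of rooks
  and bishops. So it need not be quantified, and no divisibility condition arises.\<close>
lemma definable_on_ray:
  assumes "u \<in> rook_dirs \<union> bishop_dirs" "definable_square s" "definable_square t"
  shows "definable (\<lambda>e. on_ray u (s e) (t e))"
proof -
  define n where "n p q = (if fst u \<noteq> 0 then fst u * (fst q - fst p) else snd u * (snd q - snd p))"
    for p q :: square
  have "on_ray u p q \<longleftrightarrow> 0 < n p q \<and> q = offset p (n p q) u" for p q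
  proof
    assume "on_ray u p q"
    then obtain k where k: "k > 0" "q = offset p k u"
      unfolding on_ray_def by blast
    then have "n p q = k"
      using assms(1) by (auto simp: n_def offset_def rook_dirs_def bishop_dirs_def)
    then show "0 < n p q \<and> q = offset p (n p q) u" using k by simp
  qed (auto simp: on_ray_def)
  moreover have "piecewise_affine (\<lambda>e. n (s e) (t e))"
    using assms(2,3) unfolding n_def definable_square_def
    by (intro piecewise_affine_intros definable_const) auto
  then have "definable (\<lambda>e. 0 < n (s e) (t e) \<and> t e = offset (s e) (n (s e) (t e)) u)"
    using assms(2,3) unfolding offset_def
    by (intro definable_intros definable_square_eq)
      (auto simp: definable_square_def mult.commute[of _ "fst u"] mult.commute[of _ "snd u"]
        intro!: piecewise_affine_intros)
  ultimately show ?thesis by simp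
qed


section \<open>Chess rules\<close>

text \<open>The type of the piece must not depend on the environment: the type determines which rule of
  movement applies, and it is fixed by the piece specification.\<close>
definition definable_piece :: "(env \<Rightarrow> piece) \<Rightarrow> bool" where
  "definable_piece d \<longleftrightarrow>
     (\<exists>\<tau>. \<forall>e. ptype (d e) = \<tau>) \<and> definable (\<lambda>e. live (d e)) \<and> definable_square (\<lambda>e. loc (d e))"

lemma definable_piece_live: "definable_piece d \<Longrightarrow> definable (\<lambda>e. live (d e))"
  and definable_piece_loc: "definable_piece d \<Longrightarrow> definable_square (\<lambda>e. loc (d e))"
  unfolding definable_piece_def by blast+

lemma definable_piece_ptype: "definable_piece d \<Longrightarrow> definable (\<lambda>e. ptype (d e) = \<tau>)"
  and definable_piece_pcolor: "definable_piece d \<Longrightarrow> definable (\<lambda>e. pcolor (d e) = c)"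
  unfolding definable_piece_def by (auto simp: definable_const)

lemmas definable_piece_intros =
  definable_piece_live definable_piece_loc definable_piece_ptype definable_piece_pcolor

lemma definable_piece_eq:
  assumes "definable_piece d" "definable_piece d'"
  shows "definable (\<lambda>e. d e = d' e)"
proof -
  obtain \<tau> where \<tau>: "\<And>e. ptype (d' e) = \<tau>"
    using assms(2) unfolding definable_piece_def by blast
  have "d e = d' e \<longleftrightarrow> ptype (d e) = \<tau> \<and> (live (d e) \<longleftrightarrow> live (d' e)) \<and> loc (d e) = loc (d' e)"
    for e
    using \<tau>[of e] by (auto intro: piece.equality)
  then show ?thesis
    using assms by simp
      (intro definable_intros definable_square_eq definable_piece_intros)
qed

text \<open>A position with a fixed piece specification is a list of functions instead of a function
  into lists. Its length is then constant, and quantifiers over its elements are finite.\<close>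
abbreviation family :: "(env \<Rightarrow> piece) list \<Rightarrow> env \<Rightarrow> piece list" where
  "family ds e \<equiv> map (\<lambda>d. d e) ds"

abbreviation definable_family :: "(env \<Rightarrow> piece) list \<Rightarrow> bool" where
  "definable_family ds \<equiv> \<forall>d\<in>set ds. definable_piece d"

lemma definable_family_bex:
  assumes "\<And>d. d \<in> set ds \<Longrightarrow> definable (\<lambda>e. P e (d e))"
  shows "definable (\<lambda>e. \<exists>d\<in>set (family ds e). P e d)"
  using definable_bex[of "set ds" "\<lambda>d e. P e (d e)"] assms by simp

lemma definable_family_eq:
  assumes "definable_family ds" "definable_family ds'"
  shows "definable (\<lambda>e. family ds e = family ds' e)"
proof (cases "length ds = length ds'")
  case True
  then have "family ds e = family ds' e \<longleftrightarrow> (\<forall>i<length ds. (ds ! i) e = (ds' ! i) e)" for e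
    by (auto simp: list_eq_iff_nth_eq)
  then show ?thesis
    using assms True by (simp, intro definable_all_less definable_piece_eq) auto
next
  case False
  then have "family ds e \<noteq> family ds' e" for e
    by (metis length_map)
  then show ?thesis by (simp add: definable_const)
qed

lemma definable_occupied:
  assumes "definable_family ds" "definable_square t"
  shows "definable (\<lambda>e. occupied (family ds e) (t e))"
  unfolding occupied_def
  by (intro definable_family_bex definable_intros definable_square_eq definable_piece_intros)
    (use assms in auto)

lemma definable_occupied_by:
  assumes "definable_family ds" "definable_square t"
  shows "definable (\<lambda>e. occupied_by c (family ds e) (t e))"
  unfolding occupied_by_def
  by (intro definable_family_bex definable_intros definable_square_eq definable_piece_intros)
    (use assms in auto)

lemma definable_slides:
  assumes "U \<subseteq> rook_dirs \<union> bishop_dirs" "definable_family ds"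
    "definable_square s" "definable_square t"
  shows "definable (\<lambda>e. slides U (family ds e) (s e) (t e))"
proof -
  have U: "(0, 0) \<notin> U" "finite U"
    using assms(1) by (auto simp: rook_dirs_def bishop_dirs_def intro: finite_subset)
  show ?thesis
    unfolding slides_iff_on_ray[OF U(1)]
    by (intro definable_bex definable_family_bex definable_intros definable_on_ray
          definable_piece_intros)
      (use assms U in auto)
qed

lemma definable_attacks:
  assumes "definable_family ds" "definable_piece d" "definable_square t"
  shows "definable (\<lambda>e. attacks (family ds e) (d e) (t e))"
proof -
  obtain c k where d: "\<And>e. ptype (d e) = (c, k)"
    using assms(2) unfolding definable_piece_def by (metis prod.collapse)
  have fin: "finite rook_dirs" "finite bishop_dirs" "finite knight_jumps"
    by (auto simp: rook_dirs_def bishop_dirs_def knight_jumps_def)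
  note rules = definable_conj definable_steps definable_slides definable_piece_intros
  show ?thesis
    unfolding attacks_def d
    by (cases k) (simp_all add: rules assms fin)
qed

lemma definable_in_check:
  assumes "definable_family ds"
  shows "definable (\<lambda>e. in_check c (family ds e))"
  unfolding in_check_def
  by (intro definable_family_bex definable_intros definable_attacks definable_piece_intros)
    (use assms in auto)

lemma definable_can_move:
  assumes "definable_family ds" "definable_piece d" "definable_square t"
  shows "definable (\<lambda>e. can_move (family ds e) (d e) (t e))"
proof -
  obtain c k where d: "\<And>e. ptype (d e) = (c, k)"
    using assms(2) unfolding definable_piece_def by (metis prod.collapse)
  show ?thesis
    unfolding can_move_def d
    by (intro definable_intros definable_occupied definable_occupied_by definable_attacks
          definable_steps definable_piece_intros)
      (use assms in auto)
qed

lemma definable_piece_update_loc: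
  assumes "definable_piece d" "definable_square t"
  shows "definable_piece (\<lambda>e. (d e)\<lparr>loc := t e\<rparr>)"
  using assms unfolding definable_piece_def by auto

definition capture_family ::
  "(env \<Rightarrow> square) \<Rightarrow> (env \<Rightarrow> piece) list \<Rightarrow> (env \<Rightarrow> piece) list" where
  "capture_family t ds =
     map (\<lambda>d e. if live (d e) \<and> loc (d e) = t e
                then (d e)\<lparr>live := False, loc := default_loc\<rparr> else d e) ds"

lemma family_capture: "family (capture_family t ds) e = capture_at (t e) (family ds e)"
  by (simp add: capture_family_def capture_at_def)

lemma definable_family_capture:
  assumes "definable_family ds" "definable_square t"
  shows "definable_family (capture_family t ds)"
proof -
  have "definable_piece (\<lambda>e. if live (d e) \<and> loc (d e) = t e
          then (d e)\<lparr>live := False, loc := default_loc\<rparr> else d e)"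
    if d: "definable_piece d" for d
  proof -
    have "definable (\<lambda>e. live (d e) \<and> loc (d e) = t e)"
      using d assms by (intro definable_conj definable_square_eq definable_piece_intros)
    moreover have "definable_square (\<lambda>e. default_loc)"
      by (simp add: definable_square_def piecewise_affine_const)
    ultimately show ?thesis
      using d unfolding definable_piece_def if_distrib[of ptype] if_distrib[of live] if_distrib[of loc]
      by (intro conjI definable_if definable_square_if) (auto simp: definable_const)
  qed
  then show ?thesis
    using assms by (auto simp: capture_family_def)
qed

text \<open>This removes the quantifier over target squares: entry \<open>i\<close> of the new list is the moved piece,
  and its location is the target. Equal lengths make sure that entry \<open>i\<close> exists.\<close>
lemma legal_move_iff_target:
  assumes "length (pieces q) = length (pieces p)"
  shows "legal_move p q \<longleftrightarrow>
     (\<exists>i < length (pieces p). let t = loc (pieces q ! i) in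
        pcolor (pieces p ! i) = turn p \<and>
        can_move (pieces p) (pieces p ! i) t \<and>
        pieces q = (capture_at t (pieces p))[i := (pieces p ! i)\<lparr>loc := t\<rparr>] \<and>
        turn q = opponent (turn p) \<and>
        \<not> in_check (turn p) (pieces q))"
proof -
  have "t = loc (pieces q ! i)"
    if "i < length (pieces p)"
      "pieces q = (capture_at t (pieces p))[i := (pieces p ! i)\<lparr>loc := t\<rparr>]" for i t
    using that by (simp add: capture_at_def)
  then show ?thesis
    unfolding legal_move_def Let_def by blast
qed

abbreviation position_family :: "(env \<Rightarrow> piece) list \<Rightarrow> (env \<Rightarrow> bool) \<Rightarrow> env \<Rightarrow> position" where
  "position_family ds w e \<equiv> \<lparr>pieces = family ds e, turn = if w e then White else Black\<rparr>"

lemma definable_valid_position: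
  assumes "definable_family ds"
  shows "definable (\<lambda>e. valid_position (position_family ds w e))"
proof -
  have "\<exists>A. \<forall>e. map ptype (family ds e) = A"
    using assms
  proof (induction ds)
    case (Cons d ds)
    then show ?case unfolding definable_piece_def by fastforce
  qed auto
  then obtain A where A: "\<And>e. map ptype (family ds e) = A" by blast
  have "valid_position (position_family ds w e) \<longleftrightarrow>
     at_most_one_king_each A \<and>
     (\<forall>d \<in> set ds. \<not> live (d e) \<longrightarrow> loc (d e) = default_loc) \<and>
     (\<forall>i < length ds. \<forall>j < length ds.
        i \<noteq> j \<and> live ((ds ! i) e) \<and> live ((ds ! j) e) \<longrightarrow> loc ((ds ! i) e) \<noteq> loc ((ds ! j) e))" for e
    unfolding valid_position_def using A[of e] by simp
  then show ?thesis
    using assms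
    by (simp, intro definable_conj definable_ball definable_all_less definable_intros
          definable_square_eq definable_piece_intros)
      (auto simp: definable_square_def piecewise_affine_const)
qed

lemma definable_legal_move:
  assumes "definable_family ds" "definable_family ds'" "length ds' = length ds"
    "definable w" "definable w'"
  shows "definable (\<lambda>e. legal_move (position_family ds w e) (position_family ds' w' e))"
proof -
  let ?t = "\<lambda>i e. loc ((ds' ! i) e)"
  let ?moved = "\<lambda>i. (capture_family (?t i) ds)[i := \<lambda>e. ((ds ! i) e)\<lparr>loc := ?t i e\<rparr>]"
  have len: "length (pieces (position_family ds' w' e)) = length (pieces (position_family ds w e))"
    for e using assms(3) by simp
  have "legal_move (position_family ds w e) (position_family ds' w' e) \<longleftrightarrow>
     (\<exists>i < length ds.
        pcolor ((ds ! i) e) = (if w e then White else Black) \<and>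
        can_move (family ds e) ((ds ! i) e) (?t i e) \<and>
        family ds' e = family (?moved i) e \<and>
        (w e \<longleftrightarrow> \<not> w' e) \<and>
        (if w e then \<not> in_check White (family ds' e) else \<not> in_check Black (family ds' e)))" for e
    unfolding legal_move_iff_target[OF len] Let_def
    using assms(3)
    by (cases "w e"; cases "w' e"; simp add: map_update family_capture cong: conj_cong)
  moreover have "definable (\<lambda>e. pcolor ((ds ! i) e) = (if w e then White else Black))"
    if "i < length ds" for i
  proof -
    have "pcolor ((ds ! i) e) = (if w e then White else Black) \<longleftrightarrow>
        (if w e then pcolor ((ds ! i) e) = White else pcolor ((ds ! i) e) = Black)" for e
      by simp
    then show ?thesis
      using assms that by (simp only:) (intro definable_if definable_piece_intros, auto)
  qed
  moreover have "definable_family (?moved i)" if "i < length ds" for i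
  proof -
    have "definable_family (capture_family (?t i) ds)"
      using assms that by (intro definable_family_capture definable_piece_loc) auto
    moreover have "definable_piece (\<lambda>e. ((ds ! i) e)\<lparr>loc := ?t i e\<rparr>)"
      using assms that by (intro definable_piece_update_loc definable_piece_loc) auto
    ultimately show ?thesis
      using set_update_subset_insert by (metis (no_types, lifting) insertE subset_iff)
  qed
  ultimately show ?thesis
    using assms
    by (simp only:, intro definable_ex_less definable_conj definable_can_move definable_family_eq
          definable_if definable_iff definable_not definable_in_check definable_piece_intros)
      auto
qed


section \<open>Reading codes\<close>

definition int_at :: "nat \<Rightarrow> env \<Rightarrow> int" where
  "int_at i e = (if e i = 0 then int (e (i + 1)) else - int (e (i + 1)))"

text \<open>A sign bit \<open>1\<close> before the absolute value \<open>0\<close> would be a second code of zero.\<close>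
definition int_ok :: "nat \<Rightarrow> env \<Rightarrow> bool" where
  "int_ok i e \<longleftrightarrow> e i = 0 \<or> e i = 1 \<and> e (i + 1) \<noteq> 0"

lemma int_code_iff: "int_code x = [e i, e (i + 1)] \<longleftrightarrow> int_ok i e \<and> x = int_at i e"
  by (auto simp: int_code_def int_ok_def int_at_def)

definition piece_at :: "piece_type \<Rightarrow> nat \<Rightarrow> env \<Rightarrow> piece" where
  "piece_at \<tau> i e = \<lparr>ptype = \<tau>, live = (e (i + 1) = 1), loc = (int_at (i + 2) e, int_at (i + 4) e)\<rparr>"

definition piece_ok :: "(piece_type \<Rightarrow> nat) \<Rightarrow> piece_type \<Rightarrow> nat \<Rightarrow> env \<Rightarrow> bool" where
  "piece_ok \<nu> \<tau> i e \<longleftrightarrow>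
     e i = \<nu> \<tau> \<and> (e (i + 1) = 0 \<or> e (i + 1) = 1) \<and> int_ok (i + 2) e \<and> int_ok (i + 4) e"

lemma length_piece_code: "length (piece_code \<nu> d) = 6"
  by (simp add: piece_code_def int_code_def)

text \<open>Stated as an equivalence, this yields both directions at once: which environments carry the
  code of a piece, and which piece they code. The two lifted versions below follow the same
  pattern.\<close>
lemma piece_code_iff:
  "ptype d = \<tau> \<and> piece_code \<nu> d = map e [i..<i + 6] \<longleftrightarrow> piece_ok \<nu> \<tau> i e \<and> d = piece_at \<tau> i e"
proof -
  have upt: "map e [i..<i + 6] = [e i, e (i + 1)] @ [e (i + 2), e (i + 2 + 1)] @ [e (i + 4), e (i + 4 + 1)]"
    by (simp add: upt_rec numeral_eq_Suc)
  have split: "[a, b] @ int_code x @ int_code y = [a', b'] @ [s, n] @ [s', n'] \<longleftrightarrow>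
      a = a' \<and> b = b' \<and> int_code x = [s, n] \<and> int_code y = [s', n']" for a b x y a' b' s n s' n'
    by (auto simp: int_code_def)
  have "piece_code \<nu> d = map e [i..<i + 6] \<longleftrightarrow>
      e i = \<nu> (ptype d) \<and> e (i + 1) = (if live d then 1 else 0) \<and>
      int_code (fst (loc d)) = [e (i + 2), e (i + 2 + 1)] \<and>
      int_code (snd (loc d)) = [e (i + 4), e (i + 4 + 1)]"
    unfolding piece_code_def upt split by auto
  also have "\<dots> \<longleftrightarrow> e i = \<nu> (ptype d) \<and> e (i + 1) = (if live d then 1 else 0) \<and>
      (int_ok (i + 2) e \<and> fst (loc d) = int_at (i + 2) e) \<and>
      (int_ok (i + 4) e \<and> snd (loc d) = int_at (i + 4) e)"
    unfolding int_code_iff ..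
  finally show ?thesis
    by (cases d) (auto simp: piece_at_def piece_ok_def prod_eq_iff)
qed

lemma definable_int_ok: "definable (int_ok i)"
  unfolding int_ok_def[abs_def] by (intro definable_intros)

lemma definable_piece_ok: "definable (piece_ok \<nu> \<tau> i)"
  unfolding piece_ok_def[abs_def] by (intro definable_intros definable_int_ok)

lemma definable_piece_at: "definable_piece (piece_at \<tau> i)"
proof -
  have "piecewise_affine (int_at j)" for j
    unfolding int_at_def[abs_def] by (intro piecewise_affine_intros definable_var_eq)
  then show ?thesis
    by (simp add: definable_piece_def definable_square_def piece_at_def definable_var_eq)
qed

primrec pieces_from :: "piece_type list \<Rightarrow> nat \<Rightarrow> (env \<Rightarrow> piece) list" where
  "pieces_from [] i = []"
| "pieces_from (\<tau> # A) i = piece_at \<tau> i # pieces_from A (i + 6)"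

primrec pieces_ok :: "(piece_type \<Rightarrow> nat) \<Rightarrow> piece_type list \<Rightarrow> nat \<Rightarrow> env \<Rightarrow> bool" where
  "pieces_ok \<nu> [] i e \<longleftrightarrow> True"
| "pieces_ok \<nu> (\<tau> # A) i e \<longleftrightarrow> piece_ok \<nu> \<tau> i e \<and> pieces_ok \<nu> A (i + 6) e"

lemma length_pieces_from: "length (pieces_from A i) = length A"
  by (induction A arbitrary: i) auto

lemma definable_pieces_from: "definable_family (pieces_from A i)"
  by (induction A arbitrary: i) (auto simp: definable_piece_at)

lemma definable_pieces_ok: "definable (pieces_ok \<nu> A i)"
proof (induction A arbitrary: i)
  case Nil
  have "pieces_ok \<nu> [] i = (\<lambda>e. True)" by (rule ext) simp
  then show ?case by (simp only: definable_True)
next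
  case (Cons \<tau> A)
  have "pieces_ok \<nu> (\<tau> # A) i = (\<lambda>e. piece_ok \<nu> \<tau> i e \<and> pieces_ok \<nu> A (i + 6) e)"
    by (rule ext) simp
  then show ?case by (simp only: definable_conj definable_piece_ok Cons.IH)
qed

text \<open>All codes of pieces have length six, so a concatenation of codes splits uniquely.\<close>
lemma pieces_code_iff:
  "map ptype ds = A \<and> concat (map (piece_code \<nu>) ds) = map e [i..<i + 6 * length A] \<longleftrightarrow>
     pieces_ok \<nu> A i e \<and> ds = family (pieces_from A i) e"
proof (induction A arbitrary: ds i)
  case Nil
  then show ?case by auto
next
  case (Cons \<tau> A)
  have upt: "map e [i..<i + 6 * length (\<tau> # A)] =
      map e [i..<i + 6] @ map e [i + 6..<i + 6 + 6 * length A]"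
    by (metis add.assoc length_Cons map_append mult_Suc_right upt_add_eq_append le_add1)
  show ?case
  proof (cases ds)
    case (Cons d ds')
    have "map ptype ds = \<tau> # A \<and>
        concat (map (piece_code \<nu>) ds) = map e [i..<i + 6 * length (\<tau> # A)] \<longleftrightarrow>
        (ptype d = \<tau> \<and> piece_code \<nu> d = map e [i..<i + 6]) \<and>
        (map ptype ds' = A \<and>
         concat (map (piece_code \<nu>) ds') = map e [i + 6..<i + 6 + 6 * length A])"
      unfolding upt Cons by (auto simp: append_eq_append_conv length_piece_code)
    then show ?thesis
      unfolding piece_code_iff Cons.IH by (auto simp: Cons)
  qed simp
qed

definition position_at :: "piece_type list \<Rightarrow> nat \<Rightarrow> env \<Rightarrow> position" where
  "position_at A i e = position_family (pieces_from A (i + 1)) (\<lambda>e. e i = 1) e"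

definition position_ok :: "(piece_type \<Rightarrow> nat) \<Rightarrow> piece_type list \<Rightarrow> nat \<Rightarrow> env \<Rightarrow> bool" where
  "position_ok \<nu> A i e \<longleftrightarrow> (e i = 0 \<or> e i = 1) \<and> pieces_ok \<nu> A (i + 1) e"

definition code_length :: "piece_type list \<Rightarrow> nat" where
  "code_length A = 1 + 6 * length A"

lemma position_code_iff:
  "map ptype (pieces p) = A \<and> position_code \<nu> p = map e [i..<i + code_length A] \<longleftrightarrow>
     position_ok \<nu> A i e \<and> p = position_at A i e"
proof -
  have upt: "map e [i..<i + code_length A] = e i # map e [i + 1..<i + 1 + 6 * length A]"
    by (simp add: code_length_def upt_rec)
  have "map ptype (pieces p) = A \<and> position_code \<nu> p = map e [i..<i + code_length A] \<longleftrightarrow>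
      e i = (if turn p = White then 1 else 0) \<and>
      (map ptype (pieces p) = A \<and>
       concat (map (piece_code \<nu>) (pieces p)) = map e [i + 1..<i + 1 + 6 * length A])"
    unfolding upt position_code_def by auto
  also have "\<dots> \<longleftrightarrow> position_ok \<nu> A i e \<and> p = position_at A i e"
    unfolding pieces_code_iff position_ok_def position_at_def
    by (cases p; cases "turn p") auto
  finally show ?thesis .
qed

lemma length_position_code:
  "map ptype (pieces p) = A \<Longrightarrow> length (position_code \<nu> p) = code_length A"
  by (auto simp: position_code_def code_length_def length_concat o_def length_piece_code
      sum_list_triv)

lemma map_zero_extend: "map (zero_extend v) [0..<length v] = v"
  by (rule nth_equalityI) (auto simp: zero_extend_def)

definition codes :: "(piece_type \<Rightarrow> nat) \<Rightarrow> piece_type list \<Rightarrow> nat \<Rightarrow> env \<Rightarrow> bool" where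
  "codes \<nu> A i e \<longleftrightarrow> position_ok \<nu> A i e \<and> position_at A i e \<in> positions A"

lemma codes_iff:
  "p \<in> positions A \<and> position_code \<nu> p = map e [i..<i + code_length A] \<longleftrightarrow>
     codes \<nu> A i e \<and> p = position_at A i e"
  using position_code_iff[of p A \<nu> e i] unfolding codes_def positions_def by auto

lemma definable_codes: "definable (codes \<nu> A i)"
proof -
  have "map ptype (family (pieces_from A j) e) = A" for j e
    by (induction A arbitrary: j) (auto simp: piece_at_def)
  then have "codes \<nu> A i e \<longleftrightarrow> ((e i = 0 \<or> e i = 1) \<and> pieces_ok \<nu> A (i + 1) e) \<and>
      valid_position (position_family (pieces_from A (i + 1)) (\<lambda>e. e i = 1) e)" for e
    unfolding codes_def position_ok_def positions_def position_at_def by simp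
  then have "codes \<nu> A i = (\<lambda>e. ((e i = 0 \<or> e i = 1) \<and> pieces_ok \<nu> A (i + 1) e) \<and>
      valid_position (position_family (pieces_from A (i + 1)) (\<lambda>e. e i = 1) e))"
    by blast
  then show ?thesis
    by (simp only:) (intro definable_intros definable_pieces_ok definable_valid_position
        definable_pieces_from)
qed

lemma inj_on_position_code: "inj_on (position_code \<nu>) (positions A)"
proof (rule inj_onI)
  fix p q
  assume p: "p \<in> positions A" and q: "q \<in> positions A"
    and eq: "position_code \<nu> p = position_code \<nu> q"
  let ?e = "zero_extend (position_code \<nu> p)"
  have "length (position_code \<nu> p) = code_length A"
    using p length_position_code unfolding positions_def by blast
  then have "position_code \<nu> p = map ?e [0..<0 + code_length A]"
    by (metis add_0 map_zero_extend)
  then show "p = q"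
    using codes_iff p q eq by metis
qed

lemma presburger_definable_unary:
  assumes "definable (\<lambda>e. R (position_at A 0 e))"
  shows "presburger_definable (code_length A) (position_code \<nu> ` {p \<in> positions A. R p})"
proof -
  have "position_code \<nu> ` {p \<in> positions A. R p} =
    {v. length v = code_length A \<and>
        codes \<nu> A 0 (zero_extend v) \<and> R (position_at A 0 (zero_extend v))}" (is "?L = ?R")
  proof (intro set_eqI iffI)
    fix v
    assume "v \<in> ?L"
    then obtain p where p: "p \<in> positions A" "R p" "v = position_code \<nu> p" by blast
    then have len: "length v = code_length A"
      using length_position_code unfolding positions_def by blast
    then have "position_code \<nu> p = map (zero_extend v) [0..<0 + code_length A]"
      using map_zero_extend[of v] p(3) by simp
    with p(1) have "codes \<nu> A 0 (zero_extend v) \<and> p = position_at A 0 (zero_extend v)"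
      by (intro codes_iff[THEN iffD1] conjI)
    then show "v \<in> ?R" using p(2) len by auto
  next
    fix v
    assume v: "v \<in> ?R"
    then have "position_at A 0 (zero_extend v) \<in> positions A \<and>
        position_code \<nu> (position_at A 0 (zero_extend v)) =
          map (zero_extend v) [0..<0 + code_length A]"
      by (intro codes_iff[THEN iffD2]) simp
    moreover have "map (zero_extend v) [0..<0 + code_length A] = v"
      using v map_zero_extend[of v] by simp
    ultimately show "v \<in> ?L" using v
      by (intro image_eqI[of _ _ "position_at A 0 (zero_extend v)"]) simp_all
  qed
  then show ?thesis
    using presburger_definableI[OF definable_conj[OF definable_codes assms], of "code_length A"]
    by simp
qed

text \<open>The code of the second position starts at coordinate \<open>code_length A\<close>; this is why \<open>codes\<close> and
  \<open>position_at\<close> take an offset.\<close>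
lemma presburger_definable_binary:
  assumes "definable (\<lambda>e. R (position_at A 0 e) (position_at A (code_length A) e))"
  shows "presburger_definable (2 * code_length A)
    {position_code \<nu> p @ position_code \<nu> q | p q. p \<in> positions A \<and> q \<in> positions A \<and> R p q}"
proof -
  let ?m = "code_length A"
  have split: "map e [0..<2 * ?m] = map e [0..<0 + ?m] @ map e [?m..<?m + ?m]" for e :: env
    by (metis add_0 map_append mult_2 upt_add_eq_append zero_le)
  have "{position_code \<nu> p @ position_code \<nu> q | p q. p \<in> positions A \<and> q \<in> positions A \<and> R p q} =
    {v. length v = 2 * ?m \<and> codes \<nu> A 0 (zero_extend v) \<and> codes \<nu> A ?m (zero_extend v) \<and>
        R (position_at A 0 (zero_extend v)) (position_at A ?m (zero_extend v))}" (is "?L = ?R")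
  proof (intro set_eqI iffI)
    fix v
    assume "v \<in> ?L"
    then obtain p q where pq: "p \<in> positions A" "q \<in> positions A" "R p q"
      "v = position_code \<nu> p @ position_code \<nu> q" by blast
    then have len: "length (position_code \<nu> p) = ?m" "length (position_code \<nu> q) = ?m"
      using length_position_code unfolding positions_def by blast+
    then have len': "length v = 2 * ?m" using pq by simp
    have "map (zero_extend v) [0..<0 + ?m] @ map (zero_extend v) [?m..<?m + ?m] = v"
      using map_zero_extend[of v] split[of "zero_extend v"] len' by simp
    then have "position_code \<nu> p = map (zero_extend v) [0..<0 + ?m] \<and>
        position_code \<nu> q = map (zero_extend v) [?m..<?m + ?m]"
      unfolding pq(4) using len by (subst (asm) append_eq_append_conv) auto
    then have "codes \<nu> A 0 (zero_extend v) \<and> p = position_at A 0 (zero_extend v)"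
      "codes \<nu> A ?m (zero_extend v) \<and> q = position_at A ?m (zero_extend v)"
      using pq(1,2) by (intro codes_iff[THEN iffD1]; simp)+
    then show "v \<in> ?R" using pq(3) len' by auto
  next
    fix v
    assume v: "v \<in> ?R"
    let ?p = "position_at A 0 (zero_extend v)" and ?q = "position_at A ?m (zero_extend v)"
    have "?p \<in> positions A \<and> position_code \<nu> ?p = map (zero_extend v) [0..<0 + ?m]"
      "?q \<in> positions A \<and> position_code \<nu> ?q = map (zero_extend v) [?m..<?m + ?m]"
      using v by (intro codes_iff[THEN iffD2]; simp)+
    moreover have "map (zero_extend v) [0..<0 + ?m] @ map (zero_extend v) [?m..<?m + ?m] = v"
      using v map_zero_extend[of v] split[of "zero_extend v"] by simp
    ultimately have "v = position_code \<nu> ?p @ position_code \<nu> ?q" "?p \<in> positions A" "?q \<in> positions A"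
      by simp_all
    moreover have "R ?p ?q" using v by simp
    ultimately show "v \<in> ?L" by blast
  qed
  then show ?thesis
    using presburger_definableI[OF definable_conj[OF definable_codes
        definable_conj[OF definable_codes assms]], of "2 * ?m"]
    by simp
qed


section \<open>Definability of chess\<close>

text \<open>The numbering of the piece types is arbitrary: an entry of the code that holds a type is
  only ever compared with the number of the type prescribed by \<open>A\<close>.\<close>
lemma chess_presburger_definable:
  "presburger_definable_via (code_length A) (position_code \<nu>) (chess A)"
proof -
  note fam = definable_pieces_from
  have unary: "(\<lambda>ps. concat (map (position_code \<nu>) ps)) ` {[p] | p. p \<in> positions A \<and> R p} =
      position_code \<nu> ` {p \<in> positions A. R p}" for R
    by force
  have binary: "(\<lambda>ps. concat (map (position_code \<nu>) ps)) `
        {[p, q] | p q. p \<in> positions A \<and> q \<in> positions A \<and> R p q} =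
      {position_code \<nu> p @ position_code \<nu> q | p q. p \<in> positions A \<and> q \<in> positions A \<and> R p q}" for R
    by force
  have "presburger_definable (chess_arity r * code_length A)
          ((\<lambda>ps. concat (map (position_code \<nu>) ps)) ` chess_interp A r)" for r
  proof (cases r)
    case WhiteToPlay
    have "definable (\<lambda>e. turn (position_at A 0 e) = White)"
      by (simp add: position_at_def definable_var_eq)
    then show ?thesis
      using presburger_definable_unary[of "\<lambda>p. turn p = White"] by (simp add: WhiteToPlay unary)
  next
    case OneMove
    have "definable (\<lambda>e. legal_move (position_at A 0 e) (position_at A (code_length A) e))"
      unfolding position_at_def
      by (intro definable_legal_move fam definable_var_eq) (simp add: length_pieces_from)
    then show ?thesis
      using presburger_definable_binary[of legal_move] by (simp add: OneMove binary)
  next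
    case BlackInCheck
    have "definable (\<lambda>e. in_check Black (pieces (position_at A 0 e)))"
      using definable_in_check[OF fam] by (simp add: position_at_def)
    then show ?thesis
      using presburger_definable_unary[of "\<lambda>p. in_check Black (pieces p)"]
      by (simp add: BlackInCheck unary)
  next
    case WhiteInCheck
    have "definable (\<lambda>e. in_check White (pieces (position_at A 0 e)))"
      using definable_in_check[OF fam] by (simp add: position_at_def)
    then show ?thesis
      using presburger_definable_unary[of "\<lambda>p. in_check White (pieces p)"]
      by (simp add: WhiteInCheck unary)
  qed
  moreover have "presburger_definable (code_length A) (position_code \<nu> ` positions A)"
    using presburger_definable_unary[of "\<lambda>_. True", OF definable_const] by simp
  moreover have "\<forall>p\<in>positions A. length (position_code \<nu> p) = code_length A"
    using length_position_code unfolding positions_def by blast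
  ultimately show ?thesis
    unfolding presburger_definable_via_def chess_def by (simp add: inj_on_position_code)
qed

theorem mainTheorem3:
  fixes A :: "piece_type list"
  assumes "at_most_one_king_each A"
  shows "\<exists>m \<nu>. inj \<nu> \<and> presburger_definable_via m (position_code \<nu>) (chess A)"
proof -
  have "finite (UNIV :: piece_type set)"
  proof -
    have "(UNIV :: color set) = {White, Black}"
      using color.exhaust by auto
    moreover have "(UNIV :: kind set) = {King, Queen, Bishop, Knight, Rook, Pawn}"
      using kind.exhaust by auto
    ultimately show ?thesis
      by (metis finite.emptyI finite.insertI finite_cartesian_product UNIV_Times_UNIV)
  qed
  then obtain \<nu> :: "piece_type \<Rightarrow> nat" where "inj \<nu>"
    using finite_imp_inj_to_nat_seg by blast
  then show ?thesis
    using chess_presburger_definable by blast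
qed

end
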